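(* Let $m,n,r,s,t,g\in\mathbb{Q}$ with $s^2\neq t^2$, and put $$x=mg+s,\quad y=ng+t,\quad z=mg-t,\quad w=ng+s,\quad b=1,\quad a=rg+\frac{s^2+t^2}{s^2-t^2}.$$ (i) If $n^2-mrs-mrt\neq 0$ and $$g=\frac{2ms^2-2ns^2+rs^3-rs^2t+2mt^2+2nt^2-rst^2+rt^3}{2(s-t)(n^2-mrs-mrt)},$$ then $a x^2-b y^2=a z^2+b w^2$. (ii) If $m^2-nrs+nrt\neq 0$ and $$g=\frac{-2ms^2+2ns^2+rs^3+rs^2t+2mt^2+2nt^2-rst^2-rt^3}{2(s+t)(m^2-nrs+nrt)},$$ then $b x^2+a y^2=-b z^2+a w^2$. *)

theory Defs
  imports Complex_Main
begin

end

theory Submission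
  imports Defs
begin

theorem theorem2p3:
  fixes m n r s t g x y z w a b :: rat
  assumes "s^2 \<noteq> t^2"
    and "x = m * g + s"
    and "y = n * g + t"
    and "z = m * g - t"
    and "w = n * g + s"
    and "b = 1"
    and "a = r * g + (s^2 + t^2) / (s^2 - t^2)"
  shows "(n^2 - m*r*s - m*r*t \<noteq> 0 \<and>
          g = (2*m*s^2 - 2*n*s^2 + r*s^3 - r*s^2*t + 2*m*t^2 + 2*n*t^2 - r*s*t^2 + r*t^3)
              / (2 * (s - t) * (n^2 - m*r*s - m*r*t))
          \<longrightarrow> a * x^2 - b * y^2 = a * z^2 + b * w^2)
       \<and> (m^2 - n*r*s + n*r*t \<noteq> 0 \<and>
          g = (- 2*m*s^2 + 2*n*s^2 + r*s^3 + r*s^2*t + 2*m*t^2 + 2*n*t^2 - r*s*t^2 - r*t^3)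
              / (2 * (s + t) * (m^2 - n*r*s + n*r*t))
          \<longrightarrow> b * x^2 + a * y^2 = - b * z^2 + a * w^2)"
proof -
  \<comment> \<open>Naming the quotient keeps division out of the identities below: \<open>c\<close>
    enters as a free variable, tied to \<open>s\<close> and \<open>t\<close> only by the polynomial
    relation \<open>c\<close>.\<close>
  define c where "c = (s^2 + t^2) / (s^2 - t^2)"
  have st: "s - t \<noteq> 0" "s + t \<noteq> 0"
    using assms(1) by (auto simp: power2_eq_square square_eq_iff eq_neg_iff_add_eq_0)
  have c: "c * (s^2 - t^2) = s^2 + t^2"
    using assms(1) by (simp add: c_def)
  have vals: "x = m * g + s" "y = n * g + t" "z = m * g - t" "w = n * g + s" "b = 1" "a = r * g + c"
    using assms(2-7) by (simp_all add: c_def)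
  \<comment> \<open>Once \<open>c\<close> is eliminated, the constant terms cancel and the remaining equation in \<open>g\<close>
    is \<open>g\<close> times a linear one, solved by the given value.\<close>
  have i: "a * x^2 - b * y^2 = a * z^2 + b * w^2"
    if nz: "n^2 - m*r*s - m*r*t \<noteq> 0"
      and g: "g = (2*m*s^2 - 2*n*s^2 + r*s^3 - r*s^2*t + 2*m*t^2 + 2*n*t^2 - r*s*t^2 + r*t^3)
              / (2 * (s - t) * (n^2 - m*r*s - m*r*t))" (is "g = ?N / ?D")
  proof -
    have "g * ?D = ?N"
      using g nz st by (simp add: eq_divide_eq)
    \<comment> \<open>Since \<open>x^2 - z^2 = (s + t) * (2*m*g + s - t)\<close>, the factor
      \<open>s - t\<close> completes the coefficient of \<open>c\<close> to a multiple of
      \<open>s^2 - t^2\<close>. Both brackets on the right vanish, and \<open>s - t\<close> then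
      cancels.\<close>
    moreover have "(s - t) * (a * x^2 - b * y^2 - (a * z^2 + b * w^2))
        = g * (?N - g * ?D) + (2*m*g + s - t) * (c * (s^2 - t^2) - (s^2 + t^2))"
      unfolding vals by algebra
    ultimately show ?thesis
      using c st by simp
  qed
  have ii: "b * x^2 + a * y^2 = - b * z^2 + a * w^2"
    if nz: "m^2 - n*r*s + n*r*t \<noteq> 0"
      and g: "g = (- 2*m*s^2 + 2*n*s^2 + r*s^3 + r*s^2*t + 2*m*t^2 + 2*n*t^2 - r*s*t^2 - r*t^3)
              / (2 * (s + t) * (m^2 - n*r*s + n*r*t))" (is "g = ?N / ?D")
  proof -
    have "g * ?D = ?N"
      using g nz st by (simp add: eq_divide_eq)
    \<comment> \<open>Here \<open>w^2 - y^2 = (s - t) * (2*n*g + s + t)\<close>, so the missing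
      factor is \<open>s + t\<close>. Taking right side minus left makes \<open>?N - g * ?D\<close>
      appear with a plus sign.\<close>
    moreover have "(s + t) * (- b * z^2 + a * w^2 - (b * x^2 + a * y^2))
        = g * (?N - g * ?D) + (2*n*g + s + t) * (c * (s^2 - t^2) - (s^2 + t^2))"
      unfolding vals by algebra
    ultimately show ?thesis
      using c st by simp
  qed
  show ?thesis
    using i ii by blast
qed

end
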